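(* Let $A\in\mathcal{C}op_{n+k+1}$ be a copositive matrix with block structure $$A=\begin{bmatrix}A_1 & b_1 & 0\\ b_1^\top & c & b_2^\top\\ 0 & b_2 & A_2\end{bmatrix},$$ where $A_1\in\mathcal{S}^n$, $b_1\in\mathbb{R}^n$, $A_2\in\mathcal{S}^k$, $b_2\in\mathbb{R}^k$ and $c\in\mathbb{R}$. If the two submatrices $\begin{bmatrix}A_1 & b_1\\ b_1^\top & c\end{bmatrix}$ and $\begin{bmatrix}c & b_2^\top\\ b_2 & A_2\end{bmatrix}$ are in $\mathcal{M}_{n+1}$ and $\mathcal{M}_{k+1}$, respectively, then $A\in\mathcal{SPN}_{n+k+1}$.
   Context: $\mathcal{S}^n$ is the set of real symmetric $n\times n$ matrices. $\mathcal{C}op_n\subseteq\mathcal{S}^n$ is the cone of copositive matrices ($x^\top A x\ge0$ for all entrywise nonnegative $x\in\mathbb{R}^n$). $\mathcal{SPN}_n\subseteq\mathcal{S}^n$ is the cone of matrices that are the sum of a symmetric positive semidefinite matrix and a symmetric entrywise nonnegative matrix. $\mathcal{M}_n=\{A=(a_{i,j})\in\mathcal{S}^n : a_{i,j}\le a_{k,\ell} \text{ whenever } i\le k,\ j\le \ell,\ i\neq j,\ k\neq \ell\}$. *)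

theory Defs
  imports "Jordan_Normal_Form.Matrix"
begin

definition symmetric_mats :: "nat \<Rightarrow> real mat set" where
  "symmetric_mats n = {A \<in> carrier_mat n n. transpose_mat A = A}"

definition copositive_cone :: "nat \<Rightarrow> real mat set" where
  "copositive_cone n =
    {A \<in> symmetric_mats n. \<forall>x \<in> carrier_vec n. 0\<^sub>v n \<le> x \<longrightarrow> 0 \<le> x \<bullet> (A *\<^sub>v x)}"

definition psd_cone :: "nat \<Rightarrow> real mat set" where
  "psd_cone n = {A \<in> symmetric_mats n. \<forall>x \<in> carrier_vec n. 0 \<le> x \<bullet> (A *\<^sub>v x)}"

text \<open>The orders on \<^typ>\<open>real vec\<close> and \<^typ>\<open>real mat\<close> are entrywise.\<close>

definition nonneg_cone :: "nat \<Rightarrow> real mat set" where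
  "nonneg_cone n = {A \<in> symmetric_mats n. 0\<^sub>m n n \<le> A}"

definition spn_cone :: "nat \<Rightarrow> real mat set" where
  "spn_cone n = {P + N | P N. P \<in> psd_cone n \<and> N \<in> nonneg_cone n}"

definition monotone_offdiag_mats :: "nat \<Rightarrow> real mat set" where
  "monotone_offdiag_mats n =
    {A \<in> symmetric_mats n.
      \<forall>i<n. \<forall>j<n. \<forall>k<n. \<forall>l<n.
        i \<le> k \<longrightarrow> j \<le> l \<longrightarrow> i \<noteq> j \<longrightarrow> k \<noteq> l \<longrightarrow> A $$ (i, j) \<le> A $$ (k, l)}"

definition col_mat :: "'a vec \<Rightarrow> 'a mat" where
  "col_mat b = transpose_mat (mat_of_row b)"

definition scalar_mat :: "'a \<Rightarrow> 'a mat" where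
  "scalar_mat c = mat 1 1 (\<lambda>_. c)"

definition append_cols :: "'a::zero mat \<Rightarrow> 'a mat \<Rightarrow> 'a mat" where
  "append_cols A B = transpose_mat (transpose_mat A @\<^sub>r transpose_mat B)"

text \<open>The arguments are listed row by row.\<close>

definition nine_block_mat ::
  "'a::zero mat \<Rightarrow> 'a mat \<Rightarrow> 'a mat \<Rightarrow> 'a mat \<Rightarrow> 'a mat \<Rightarrow> 'a mat \<Rightarrow> 'a mat \<Rightarrow> 'a mat \<Rightarrow> 'a mat \<Rightarrow> 'a mat"
where
  "nine_block_mat A\<^sub>1\<^sub>1 A\<^sub>1\<^sub>2 A\<^sub>1\<^sub>3 A\<^sub>2\<^sub>1 A\<^sub>2\<^sub>2 A\<^sub>2\<^sub>3 A\<^sub>3\<^sub>1 A\<^sub>3\<^sub>2 A\<^sub>3\<^sub>3 =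
    append_cols A\<^sub>1\<^sub>1 (append_cols A\<^sub>1\<^sub>2 A\<^sub>1\<^sub>3) @\<^sub>r
    append_cols A\<^sub>2\<^sub>1 (append_cols A\<^sub>2\<^sub>2 A\<^sub>2\<^sub>3) @\<^sub>r
    append_cols A\<^sub>3\<^sub>1 (append_cols A\<^sub>3\<^sub>2 A\<^sub>3\<^sub>3)"

end

theory Submission
  imports Defs
begin

text \<open>
  Why the statement holds. Splitting the shared diagonal entry \<open>c = c\<^sub>1 + c\<^sub>2\<close> splits \<open>A\<close> into a sum of two
  matrices, each supported on one of the two overlapping blocks. Since the variables of the two
  blocks interact only through the shared one, which may be normalised to \<open>1\<close>, copositivity of
  \<open>A\<close> says that \<open>f x + g y + c \<ge> 0\<close> for all \<open>x, y \<ge> 0\<close>, with \<open>f\<close> and \<open>g\<close> the inhomogeneous quadratic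
  functions given by \<open>(A\<^sub>1, b\<^sub>1)\<close> and \<open>(A\<^sub>2, b\<^sub>2)\<close>. Hence \<open>f\<close> is bounded below and
  \<open>c\<^sub>1 = - inf f\<close> makes both summands copositive (\<open>copositive_on_glue\<close>). A change of diagonal entries does not affect the monotonicity
  of the blocks.

  It remains to see that a copositive matrix with monotone off-diagonal entries is the sum of a
  positive semidefinite and a nonnegative matrix (\<open>copositive_monotone_imp_spn\<close>). This is an
  induction on the size. Let \<open>u\<close> and \<open>w\<close> be the first and the last index. If \<open>a u w \<ge> 0\<close>, then
  the last row is nonnegative, off the diagonal by monotonicity and on it by copositivity, and it
  can be split off, together with the last column, as a nonnegative matrix. Otherwise all off-diagonal
  entries of the first row are negative and \<open>a u u > 0\<close>. Then the Schur complement of \<open>a u u\<close> is again copositive, because the minimiser of the form in the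
  first variable is nonnegative; it is again monotone, because the products \<open>a u i * a u j\<close> of the
  negative and increasing entries decrease. Adding back a rank-one positive semidefinite
  matrix gives the claim.

  The argument is carried out for coefficient functions on arbitrary finite sets of indices, so
  that passing to a submatrix is passing to a subset.
\<close>

section \<open>Quadratic forms on finite index sets\<close>

text \<open>The quadratic form with coefficients \<open>a\<close> in the variables indexed by \<open>I\<close>; values of \<open>a\<close>
  and \<open>x\<close> outside \<open>I\<close> are irrelevant. The notions below are relative to \<open>I\<close> in the same way.\<close>

definition qform :: "nat set \<Rightarrow> (nat \<Rightarrow> nat \<Rightarrow> real) \<Rightarrow> (nat \<Rightarrow> real) \<Rightarrow> real" where
  "qform I a x = (\<Sum>i\<in>I. \<Sum>j\<in>I. a i j * x i * x j)"

text \<open>Symmetry of the principal submatrix of \<open>a\<close> with index set \<open>I\<close>.\<close>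

definition symmetric_on :: "nat set \<Rightarrow> (nat \<Rightarrow> nat \<Rightarrow> real) \<Rightarrow> bool" where
  "symmetric_on I a \<longleftrightarrow> (\<forall>i\<in>I. \<forall>j\<in>I. a i j = a j i)"

text \<open>Copositivity of the principal submatrix; symmetry is stated separately where it is needed.\<close>

definition copositive_on :: "nat set \<Rightarrow> (nat \<Rightarrow> nat \<Rightarrow> real) \<Rightarrow> bool" where
  "copositive_on I a \<longleftrightarrow> (\<forall>x. (\<forall>i\<in>I. 0 \<le> x i) \<longrightarrow> 0 \<le> qform I a x)"

text \<open>The principal submatrix is a sum of a symmetric positive semidefinite \<open>p\<close> and a symmetric
  entrywise nonnegative \<open>m\<close>.\<close>

definition spn_on :: "nat set \<Rightarrow> (nat \<Rightarrow> nat \<Rightarrow> real) \<Rightarrow> bool" where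
  "spn_on I a \<longleftrightarrow> (\<exists>p m.
     symmetric_on I p \<and> (\<forall>x. 0 \<le> qform I p x) \<and>
     symmetric_on I m \<and> (\<forall>i\<in>I. \<forall>j\<in>I. 0 \<le> m i j) \<and>
     (\<forall>i\<in>I. \<forall>j\<in>I. a i j = p i j + m i j))"

text \<open>Off-diagonal entries increase along rows and columns; diagonal entries are unconstrained.\<close>

definition monotone_offdiag_on :: "nat set \<Rightarrow> (nat \<Rightarrow> nat \<Rightarrow> real) \<Rightarrow> bool" where
  "monotone_offdiag_on I a \<longleftrightarrow>
    (\<forall>i\<in>I. \<forall>j\<in>I. \<forall>k\<in>I. \<forall>l\<in>I. i \<le> k \<longrightarrow> j \<le> l \<longrightarrow> i \<noteq> j \<longrightarrow> k \<noteq> l \<longrightarrow> a i j \<le> a k l)"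

text \<open>The block of \<open>a\<close> with index set \<open>J\<close>, padded with zeros.\<close>

definition restrict_block :: "nat set \<Rightarrow> (nat \<Rightarrow> nat \<Rightarrow> real) \<Rightarrow> nat \<Rightarrow> nat \<Rightarrow> real" where
  "restrict_block J a i j = (if i \<in> J \<and> j \<in> J then a i j else 0)"

lemma qform_cong:
  assumes "\<And>i j. i \<in> I \<Longrightarrow> j \<in> I \<Longrightarrow> a i j = b i j" and "\<And>i. i \<in> I \<Longrightarrow> x i = y i"
  shows "qform I a x = qform I b y"
  unfolding qform_def using assms by (auto intro!: sum.cong)

lemma qform_add: "qform I (\<lambda>i j. a i j + b i j) x = qform I a x + qform I b x"
  unfolding qform_def by (simp add: algebra_simps sum.distrib)

lemma qform_diff: "qform I (\<lambda>i j. a i j - b i j) x = qform I a x - qform I b x"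
  unfolding qform_def by (simp add: algebra_simps sum_subtractf)

lemma qform_scale: "qform I a (\<lambda>i. t * x i) = t\<^sup>2 * qform I a x"
  unfolding qform_def by (simp add: sum_distrib_left power2_eq_square ac_simps)

lemma qform_rank_one: "qform I (\<lambda>i j. u i * u j) x = (\<Sum>i\<in>I. u i * x i)\<^sup>2"
  unfolding qform_def power2_eq_square sum_product by (simp add: ac_simps)

lemma qform_insert:
  assumes "finite J" "v \<notin> J" "symmetric_on (insert v J) a"
  shows "qform (insert v J) a x = a v v * (x v)\<^sup>2 + 2 * x v * (\<Sum>j\<in>J. a v j * x j) + qform J a x"
proof -
  have "a i v = a v i" if "i \<in> J" for i
    using assms(3) that unfolding symmetric_on_def by blast
  then have "(\<Sum>i\<in>J. a i v * x i * x v) = x v * (\<Sum>j\<in>J. a v j * x j)"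
    unfolding sum_distrib_left by (intro sum.cong) auto
  moreover have "(\<Sum>j\<in>J. a v j * x v * x j) = x v * (\<Sum>j\<in>J. a v j * x j)"
    unfolding sum_distrib_left by (intro sum.cong) auto
  ultimately show ?thesis
    using assms(1,2) unfolding qform_def by (simp add: sum.distrib power2_eq_square)
qed

lemma qform_restrict_block:
  assumes "finite I" "J \<subseteq> I"
  shows "qform I (restrict_block J a) x = qform J a x"
proof -
  have "qform I (restrict_block J a) x = (\<Sum>i\<in>J. \<Sum>j\<in>I. restrict_block J a i j * x i * x j)"
    unfolding qform_def using assms
    by (intro sum.mono_neutral_right) (auto simp: restrict_block_def)
  also have "\<dots> = (\<Sum>i\<in>J. \<Sum>j\<in>J. restrict_block J a i j * x i * x j)"
    using assms by (intro sum.cong sum.mono_neutral_right) (auto simp: restrict_block_def)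
  also have "\<dots> = qform J a x"
    unfolding qform_def by (auto intro!: sum.cong simp: restrict_block_def)
  finally show ?thesis .
qed

lemma qform_zero_outside:
  assumes "finite I" "J \<subseteq> I"
  shows "qform I a (\<lambda>i. if i \<in> J then x i else 0) = qform J a x"
proof -
  have "qform I a (\<lambda>i. if i \<in> J then x i else 0) = qform I (restrict_block J a) x"
    unfolding qform_def by (auto intro!: sum.cong simp: restrict_block_def)
  then show ?thesis
    using qform_restrict_block[OF assms] by simp
qed

lemma symmetric_on_subset: "symmetric_on I a \<Longrightarrow> J \<subseteq> I \<Longrightarrow> symmetric_on J a"
  unfolding symmetric_on_def by blast

lemma monotone_offdiag_onD:
  assumes "monotone_offdiag_on I a" "i \<in> I" "j \<in> I" "k \<in> I" "l \<in> I"
    "i \<le> k" "j \<le> l" "i \<noteq> j" "k \<noteq> l"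
  shows "a i j \<le> a k l"
  using assms unfolding monotone_offdiag_on_def by blast

lemma monotone_offdiag_on_subset: "monotone_offdiag_on I a \<Longrightarrow> J \<subseteq> I \<Longrightarrow> monotone_offdiag_on J a"
  unfolding monotone_offdiag_on_def by blast

lemma copositive_on_subset:
  assumes "finite I" "copositive_on I a" "J \<subseteq> I"
  shows "copositive_on J a"
  unfolding copositive_on_def
proof (intro allI impI)
  fix x :: "nat \<Rightarrow> real"
  assume "\<forall>i\<in>J. 0 \<le> x i"
  then have "0 \<le> qform I a (\<lambda>i. if i \<in> J then x i else 0)"
    using assms(2) unfolding copositive_on_def by auto
  then show "0 \<le> qform J a x"
    using qform_zero_outside[OF assms(1,3)] by simp
qed

lemma copositive_on_diag_nonneg:
  assumes "finite I" "copositive_on I a" "v \<in> I"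
  shows "0 \<le> a v v"
proof -
  have "copositive_on {v} a"
    using assms(3) by (intro copositive_on_subset[OF assms(1,2)]) simp
  then have "0 \<le> qform {v} a (\<lambda>_. 1)"
    unfolding copositive_on_def by (metis zero_le_one)
  then show ?thesis
    by (simp add: qform_def)
qed

text \<open>A zero diagonal entry of a copositive matrix forces its row to be nonnegative.\<close>

lemma copositive_on_diag_pos:
  assumes "finite I" "symmetric_on I a" "copositive_on I a"
    and "v \<in> I" "w \<in> I" "v \<noteq> w" "a v w < 0"
  shows "0 < a v v"
proof (rule ccontr)
  assume "\<not> 0 < a v v"
  then have zero: "a v v = 0"
    using copositive_on_diag_nonneg[OF assms(1,3,4)] by simp
  \<comment> \<open>With entry \<open>t\<close> at \<open>v\<close> and \<open>1\<close> at \<open>w\<close> the form takes the value \<open>-1\<close>.\<close>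
  define t where "t = - (a w w + 1) / (2 * a v w)"
  have t: "0 \<le> t"
    using copositive_on_diag_nonneg[OF assms(1,3,5)] assms(7)
    unfolding t_def by (simp add: divide_nonpos_neg)
  define x where "x = (\<lambda>i. if i = v then t else 1)"
  have "copositive_on {v, w} a"
    using assms(4,5) by (intro copositive_on_subset[OF assms(1,3)]) simp
  moreover have "\<forall>i\<in>{v, w}. 0 \<le> x i"
    using t unfolding x_def by simp
  ultimately have "0 \<le> qform {v, w} a x"
    unfolding copositive_on_def by blast
  also have "qform {v, w} a x = 2 * t * a v w + a w w"
    using qform_insert[of "{w}" v a x] symmetric_on_subset[OF assms(2), of "{v, w}"] assms(4-6) zero
    by (simp add: qform_def x_def)
  also have "\<dots> = -1"
    using assms(7) unfolding t_def by (simp add: field_simps)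
  finally show False
    by simp
qed

section \<open>Sums of positive semidefinite and nonnegative forms\<close>

lemma spn_on_cong:
  assumes "spn_on I a" and "\<And>i j. i \<in> I \<Longrightarrow> j \<in> I \<Longrightarrow> a i j = b i j"
  shows "spn_on I b"
  using assms(1) unfolding spn_on_def by (simp add: assms(2))

lemma spn_on_add:
  assumes "spn_on I a" "spn_on I b"
  shows "spn_on I (\<lambda>i j. a i j + b i j)"
proof -
  obtain p m where 1: "symmetric_on I p" "\<forall>x. 0 \<le> qform I p x" "symmetric_on I m"
    "\<forall>i\<in>I. \<forall>j\<in>I. 0 \<le> m i j" "\<forall>i\<in>I. \<forall>j\<in>I. a i j = p i j + m i j"
    using assms(1) unfolding spn_on_def by blast
  obtain q l where 2: "symmetric_on I q" "\<forall>x. 0 \<le> qform I q x" "symmetric_on I l"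
    "\<forall>i\<in>I. \<forall>j\<in>I. 0 \<le> l i j" "\<forall>i\<in>I. \<forall>j\<in>I. b i j = q i j + l i j"
    using assms(2) unfolding spn_on_def by blast
  show ?thesis
    unfolding spn_on_def
    by (rule exI[of _ "\<lambda>i j. p i j + q i j"], rule exI[of _ "\<lambda>i j. m i j + l i j"])
      (use 1 2 in \<open>auto simp: symmetric_on_def qform_add\<close>)
qed

lemma spn_on_nonneg:
  assumes "symmetric_on I m" "\<And>i j. i \<in> I \<Longrightarrow> j \<in> I \<Longrightarrow> 0 \<le> m i j"
  shows "spn_on I m"
  unfolding spn_on_def
  by (rule exI[of _ "\<lambda>_ _. 0"], rule exI[of _ m])
    (use assms in \<open>auto simp: symmetric_on_def qform_def\<close>)

lemma spn_on_rank_one: "spn_on I (\<lambda>i j. u i * u j)"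
  unfolding spn_on_def
  by (rule exI[of _ "\<lambda>i j. u i * u j"], rule exI[of _ "\<lambda>_ _. 0"])
    (auto simp: symmetric_on_def qform_rank_one)

lemma spn_on_restrict_block:
  assumes "finite I" "J \<subseteq> I" "spn_on J a"
  shows "spn_on I (restrict_block J a)"
proof -
  obtain p m where *: "symmetric_on J p" "\<forall>x. 0 \<le> qform J p x" "symmetric_on J m"
    "\<forall>i\<in>J. \<forall>j\<in>J. 0 \<le> m i j" "\<forall>i\<in>J. \<forall>j\<in>J. a i j = p i j + m i j"
    using assms(3) unfolding spn_on_def by blast
  show ?thesis
    unfolding spn_on_def
    by (rule exI[of _ "restrict_block J p"], rule exI[of _ "restrict_block J m"])
      (use * in \<open>auto simp: symmetric_on_def qform_restrict_block[OF assms(1,2)] restrict_block_def\<close>)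
qed

section \<open>Copositive matrices with monotone off-diagonal entries\<close>

lemma copositive_on_schur_complement:
  assumes "finite J" "v \<notin> J" "symmetric_on (insert v J) a" "copositive_on (insert v J) a"
    and "0 < a v v" "\<And>j. j \<in> J \<Longrightarrow> a v j \<le> 0"
  shows "copositive_on J (\<lambda>i j. a i j - a v i * a v j / a v v)"
  unfolding copositive_on_def
proof (intro allI impI)
  fix x :: "nat \<Rightarrow> real"
  assume x: "\<forall>i\<in>J. 0 \<le> x i"
  define s where "s = (\<Sum>j\<in>J. a v j * x j)"
  have s: "s \<le> 0"
    unfolding s_def using x assms(6) by (intro sum_nonpos) (simp add: mult_nonpos_nonneg)
  \<comment> \<open>The minimiser of the form in the variable \<open>v\<close>; it is nonnegative since \<open>s \<le> 0\<close>.\<close>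
  define y where "y = x(v := - s / a v v)"
  have "0 \<le> - s / a v v"
    using s assms(5) by (simp add: divide_nonpos_pos)
  then have "\<forall>i\<in>insert v J. 0 \<le> y i"
    using x unfolding y_def by simp
  then have "0 \<le> qform (insert v J) a y"
    using assms(4) unfolding copositive_on_def by blast
  also have "\<dots> = a v v * (y v)\<^sup>2 + 2 * y v * (\<Sum>j\<in>J. a v j * y j) + qform J a y"
    using qform_insert[OF assms(1-3)] .
  also have "(\<Sum>j\<in>J. a v j * y j) = s"
    unfolding s_def y_def using assms(2) by (intro sum.cong) auto
  also have "qform J a y = qform J a x"
    unfolding y_def using assms(2) by (intro qform_cong) auto
  also have "a v v * (y v)\<^sup>2 + 2 * y v * s = - (s\<^sup>2 / a v v)"
    using assms(5) unfolding y_def by (simp add: field_simps power2_eq_square)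
  also have "s\<^sup>2 / a v v = qform J (\<lambda>i j. a v i * a v j / a v v) x"
    unfolding s_def qform_rank_one[symmetric] unfolding qform_def
    by (simp add: sum_divide_distrib)
  finally show "0 \<le> qform J (\<lambda>i j. a i j - a v i * a v j / a v v) x"
    by (simp add: qform_diff)
qed

lemma spn_on_of_schur_complement:
  assumes "finite J" "v \<notin> J" "symmetric_on (insert v J) a" "0 < a v v"
    and "spn_on J (\<lambda>i j. a i j - a v i * a v j / a v v)"
  shows "spn_on (insert v J) a"
proof -
  define u where "u i = a v i / sqrt (a v v)" for i
  have u: "u i * u j = a v i * a v j / a v v" for i j
    using assms(4) unfolding u_def by simp
  have "spn_on (insert v J)
    (\<lambda>i j. restrict_block J (\<lambda>i j. a i j - a v i * a v j / a v v) i j + u i * u j)"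
    using assms(1,5) by (intro spn_on_add spn_on_restrict_block spn_on_rank_one) auto
  moreover have "a i v = a v i" if "i \<in> J" for i
    using assms(3) that unfolding symmetric_on_def by blast
  then have "restrict_block J (\<lambda>i j. a i j - a v i * a v j / a v v) i j + u i * u j = a i j"
    if "i \<in> insert v J" "j \<in> insert v J" for i j
    using that assms(2,4) unfolding restrict_block_def u by auto
  ultimately show ?thesis
    by (rule spn_on_cong)
qed

lemma copositive_monotone_imp_spn:
  assumes "finite I" "symmetric_on I a" "monotone_offdiag_on I a" "copositive_on I a"
  shows "spn_on I a"
  using assms
proof (induction "card I" arbitrary: I a rule: less_induct)
  case less
  note fin = less.prems(1) and sym = less.prems(2) and mono = less.prems(3) and cop = less.prems(4)
  show ?case
  proof (cases "I = {}")
    case True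
    then show ?thesis
      by (simp add: spn_on_def symmetric_on_def qform_def)
  next
    case nonempty: False
    define u where "u = Min I"
    define w where "w = Max I"
    have uw: "u \<in> I" "w \<in> I" and least: "\<And>i. i \<in> I \<Longrightarrow> u \<le> i" and greatest: "\<And>i. i \<in> I \<Longrightarrow> i \<le> w"
      using fin nonempty unfolding u_def w_def by auto
    show ?thesis
    proof (cases "0 \<le> a u w")
      case True
      define J where "J = I - {w}"
      have J: "card J < card I" "J \<subseteq> I" "finite J"
        using fin card_Diff1_less[OF fin uw(2)] unfolding J_def by auto
      have "spn_on J a"
        using less.hyps[OF J(1,3) symmetric_on_subset[OF sym J(2)]
            monotone_offdiag_on_subset[OF mono J(2)] copositive_on_subset[OF fin cop J(2)]] .
      define m where "m i j = (if i \<in> J \<and> j \<in> J then 0 else a i j)" for i j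
      have col: "0 \<le> a i w" if "i \<in> I" for i
      proof (cases "i = w")
        case True
        then show ?thesis
          using copositive_on_diag_nonneg[OF fin cop] that by simp
      next
        case False
        then have "u \<noteq> w"
          using least[OF that] greatest[OF that] by auto
        then have "a u w \<le> a i w"
          using that uw False least by (intro monotone_offdiag_onD[OF mono]) auto
        then show ?thesis
          using True by simp
      qed
      have row: "0 \<le> a w i" if "i \<in> I" for i
        using col[OF that] sym that uw unfolding symmetric_on_def by metis
      have "spn_on I m"
      proof (rule spn_on_nonneg)
        show "symmetric_on I m"
          using sym unfolding symmetric_on_def m_def by auto
        show "0 \<le> m i j" if "i \<in> I" "j \<in> I" for i j
          using that col row unfolding m_def J_def by auto
      qed
      then have "spn_on I (\<lambda>i j. restrict_block J a i j + m i j)"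
        using spn_on_add spn_on_restrict_block fin J \<open>spn_on J a\<close> by blast
      then show ?thesis
        by (rule spn_on_cong) (simp add: restrict_block_def m_def)
    next
      case False
      have "u \<noteq> w"
        using False copositive_on_diag_nonneg[OF fin cop] uw by auto
      have pos: "0 < a u u"
        using copositive_on_diag_pos[OF fin sym cop uw \<open>u \<noteq> w\<close>] False by simp
      define J where "J = I - {u}"
      have J: "card J < card I" "J \<subseteq> I" "finite J" "u \<notin> J" "insert u J = I"
        using fin uw(1) card_Diff1_less[OF fin uw(1)] unfolding J_def by auto
      have row: "a u j \<le> 0" if "j \<in> J" for j
      proof -
        have "a u j \<le> a u w"
          using that uw \<open>u \<noteq> w\<close> greatest unfolding J_def
          by (intro monotone_offdiag_onD[OF mono]) auto
        then show ?thesis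
          using False by simp
      qed
      have row_mono: "a u i \<le> a u k" if "i \<in> J" "k \<in> J" "i \<le> k" for i k
        using that uw unfolding J_def by (intro monotone_offdiag_onD[OF mono]) auto
      define s where "s = (\<lambda>i j. a i j - a u i * a u j / a u u)"
      have "symmetric_on J s"
        using symmetric_on_subset[OF sym J(2)] unfolding symmetric_on_def s_def by (simp add: mult.commute)
      moreover have "monotone_offdiag_on J s"
        unfolding monotone_offdiag_on_def
      proof (intro ballI impI)
        fix i j k l
        assume *: "i \<in> J" "j \<in> J" "k \<in> J" "l \<in> J" "i \<le> k" "j \<le> l" "i \<noteq> j" "k \<noteq> l"
        have "a i j \<le> a k l"
          using * J(2) by (intro monotone_offdiag_onD[OF mono]) auto
        moreover have "a u k * a u l \<le> a u i * a u j"
          using * row row_mono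
          by (intro order_trans[OF mult_right_mono_neg mult_left_mono_neg]) auto
        then have "a u k * a u l / a u u \<le> a u i * a u j / a u u"
          using pos by (simp add: divide_right_mono)
        ultimately show "s i j \<le> s k l"
          unfolding s_def by linarith
      qed
      moreover have "copositive_on J s"
        unfolding s_def using copositive_on_schur_complement[of J u a] J sym cop pos row by simp
      ultimately have "spn_on J s"
        using less.hyps J by blast
      then show ?thesis
        using spn_on_of_schur_complement[of J u a] J sym pos unfolding s_def by simp
    qed
  qed
qed

section \<open>Splitting a copositive matrix at a cut vertex\<close>

text \<open>The matrix \<open>a\<close> with its diagonal entry at \<open>v\<close> replaced by \<open>c\<close>.\<close>

definition set_diag :: "nat \<Rightarrow> real \<Rightarrow> (nat \<Rightarrow> nat \<Rightarrow> real) \<Rightarrow> nat \<Rightarrow> nat \<Rightarrow> real" where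
  "set_diag v c a i j = (if i = v \<and> j = v then c else a i j)"

lemma symmetric_on_set_diag: "symmetric_on I a \<Longrightarrow> symmetric_on I (set_diag v c a)"
  unfolding symmetric_on_def set_diag_def by auto

lemma monotone_offdiag_on_set_diag:
  "monotone_offdiag_on I a \<Longrightarrow> monotone_offdiag_on I (set_diag v c a)"
  unfolding monotone_offdiag_on_def set_diag_def by auto

lemma qform_set_diag_notin: "v \<notin> J \<Longrightarrow> qform J (set_diag v c a) x = qform J a x"
  by (rule qform_cong) (auto simp: set_diag_def)

text \<open>Dehomogenisation: by scaling, it suffices to test copositivity on vectors whose entry at
  \<open>v\<close> is \<open>1\<close> or \<open>0\<close>.\<close>

lemma copositive_on_set_diagI:
  assumes "finite J" "v \<notin> J" "symmetric_on (insert v J) a" "copositive_on J a"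
    and "\<And>x. (\<And>i. i \<in> J \<Longrightarrow> 0 \<le> x i) \<Longrightarrow> 0 \<le> c + 2 * (\<Sum>j\<in>J. a v j * x j) + qform J a x"
  shows "copositive_on (insert v J) (set_diag v c a)"
  unfolding copositive_on_def
proof (intro allI impI)
  fix x :: "nat \<Rightarrow> real"
  assume x: "\<forall>i\<in>insert v J. 0 \<le> x i"
  let ?s = "\<lambda>x. \<Sum>j\<in>J. a v j * x j"
  have "(\<Sum>j\<in>J. set_diag v c a v j * x j) = ?s x"
    using assms(2) by (intro sum.cong) (auto simp: set_diag_def)
  then have expand: "qform (insert v J) (set_diag v c a) x = c * (x v)\<^sup>2 + 2 * x v * ?s x + qform J a x"
    using qform_insert[OF assms(1,2) symmetric_on_set_diag[OF assms(3)]]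
      qform_set_diag_notin[OF assms(2)] by (simp add: set_diag_def)
  show "0 \<le> qform (insert v J) (set_diag v c a) x"
  proof (cases "x v = 0")
    case True
    then show ?thesis
      using expand assms(4) x unfolding copositive_on_def by simp
  next
    case False
    define y where "y i = x i / x v" for i
    have xy: "x = (\<lambda>i. x v * y i)"
      using False unfolding y_def by simp
    have "?s x = x v * ?s y"
      using False unfolding y_def sum_distrib_left by (intro sum.cong) auto
    moreover have "qform J a x = (x v)\<^sup>2 * qform J a y"
      using qform_scale[of J a "x v" y] xy by simp
    ultimately have "qform (insert v J) (set_diag v c a) x = (x v)\<^sup>2 * (c + 2 * ?s y + qform J a y)"
      using expand by (simp add: algebra_simps power2_eq_square)
    moreover have "0 \<le> c + 2 * ?s y + qform J a y"
      using x unfolding y_def by (intro assms(5)) auto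
    ultimately show ?thesis
      by simp
  qed
qed

text \<open>In graph terms \<open>v\<close> is a cut vertex separating \<open>J\<close> from \<open>K\<close>: the diagonal entry at \<open>v\<close> can be
  distributed between the two sides so that both remain copositive.\<close>

lemma copositive_on_glue:
  assumes fin: "finite J" "finite K" and disj: "J \<inter> K = {}" "v \<notin> J" "v \<notin> K"
    and sym: "symmetric_on (insert v (J \<union> K)) a" and cop: "copositive_on (insert v (J \<union> K)) a"
    and zero: "\<And>i j. i \<in> J \<Longrightarrow> j \<in> K \<Longrightarrow> a i j = 0"
  obtains c1 c2 where "c1 + c2 = a v v" "copositive_on (insert v J) (set_diag v c1 a)"
    "copositive_on (insert v K) (set_diag v c2 a)"
proof -
  \<comment> \<open>For \<open>L = J\<close> and \<open>L = K\<close>, the parts of the form that the two sides contribute when the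
    entry at \<open>v\<close> is \<open>1\<close>.\<close>
  define h where "h L x = 2 * (\<Sum>j\<in>L. a v j * x j) + qform L a x" for L and x :: "nat \<Rightarrow> real"
  define X where "X L = {x :: nat \<Rightarrow> real. \<forall>i\<in>L. 0 \<le> x i}" for L :: "nat set"
  have key: "0 \<le> h J x + h K y + a v v" if "x \<in> X J" "y \<in> X K" for x y
  proof -
    define z where "z i = (if i = v then 1 else if i \<in> J then x i else y i)" for i
    have zJ: "z i = x i" if "i \<in> J" for i
      using that disj unfolding z_def by auto
    have zK: "z i = y i" if "i \<in> K" for i
      using that disj unfolding z_def by auto
    have "\<forall>i\<in>insert v (J \<union> K). 0 \<le> z i"
      using that unfolding z_def X_def by auto
    then have "0 \<le> qform (insert v (J \<union> K)) a z"
      using cop unfolding copositive_on_def by blast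
    also have "\<dots> = a v v + 2 * (\<Sum>j\<in>J \<union> K. a v j * z j) + qform (J \<union> K) a z"
      using qform_insert[OF _ _ sym, of z] fin disj by (simp add: z_def)
    also have "(\<Sum>j\<in>J \<union> K. a v j * z j) = (\<Sum>j\<in>J. a v j * x j) + (\<Sum>j\<in>K. a v j * y j)"
      using fin disj zJ zK by (simp add: sum.union_disjoint)
    also have "qform (J \<union> K) a z = qform J a x + qform K a y"
    proof -
      have zero': "a i j = 0" if "i \<in> K" "j \<in> J" for i j
        using zero[OF that(2,1)] sym that unfolding symmetric_on_def by auto
      have "qform (J \<union> K) a z
          = qform (J \<union> K) (\<lambda>i j. restrict_block J a i j + restrict_block K a i j) z"
        using disj zero zero' by (intro qform_cong) (auto simp: restrict_block_def)
      also have "\<dots> = qform J a z + qform K a z"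
        using fin by (simp add: qform_add qform_restrict_block)
      also have "qform J a z = qform J a x"
        using zJ by (intro qform_cong) auto
      also have "qform K a z = qform K a y"
        using zK by (intro qform_cong) auto
      finally show ?thesis .
    qed
    finally show ?thesis
      unfolding h_def by simp
  qed
  have nonempty: "(\<lambda>_. 0) \<in> X L" for L
    unfolding X_def by simp
  define c1 where "c1 = (SUP x\<in>X J. - h J x)"
  have bdd: "bdd_above ((\<lambda>x. - h J x) ` X J)"
    by (rule bdd_aboveI[of _ "h K (\<lambda>_. 0) + a v v"]) (use key nonempty in fastforce)
  have J: "0 \<le> c1 + h J x" if "x \<in> X J" for x
    using cSUP_upper[OF that bdd] unfolding c1_def by simp
  have K: "c1 \<le> h K y + a v v" if "y \<in> X K" for y
    unfolding c1_def by (rule cSUP_least) (use key[OF _ that] nonempty in fastforce)+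
  have "copositive_on (insert v J) (set_diag v c1 a)"
  proof (rule copositive_on_set_diagI)
    show "0 \<le> c1 + 2 * (\<Sum>j\<in>J. a v j * x j) + qform J a x" if "\<And>i. i \<in> J \<Longrightarrow> 0 \<le> x i" for x
      using J[of x] that unfolding h_def X_def by simp
  qed (use fin disj in \<open>auto intro: symmetric_on_subset[OF sym] copositive_on_subset[OF _ cop]\<close>)
  moreover have "copositive_on (insert v K) (set_diag v (a v v - c1) a)"
  proof (rule copositive_on_set_diagI)
    show "0 \<le> a v v - c1 + 2 * (\<Sum>j\<in>K. a v j * x j) + qform K a x" if "\<And>i. i \<in> K \<Longrightarrow> 0 \<le> x i" for x
      using K[of x] that unfolding h_def X_def by simp
  qed (use fin disj in \<open>auto intro: symmetric_on_subset[OF sym] copositive_on_subset[OF _ cop]\<close>)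
  ultimately show ?thesis
    using that[of c1 "a v v - c1"] by simp
qed

lemma copositive_glued_monotone_imp_spn:
  assumes fin: "finite J" "finite K" and disj: "J \<inter> K = {}" "v \<notin> J" "v \<notin> K"
    and sym: "symmetric_on (insert v (J \<union> K)) a" and cop: "copositive_on (insert v (J \<union> K)) a"
    and zero: "\<And>i j. i \<in> J \<Longrightarrow> j \<in> K \<Longrightarrow> a i j = 0"
    and mono: "monotone_offdiag_on (insert v J) a" "monotone_offdiag_on (insert v K) a"
  shows "spn_on (insert v (J \<union> K)) a"
proof -
  obtain c1 c2 where c: "c1 + c2 = a v v" "copositive_on (insert v J) (set_diag v c1 a)"
    "copositive_on (insert v K) (set_diag v c2 a)"
    using copositive_on_glue[OF fin disj sym cop zero] by blast
  let ?b1 = "restrict_block (insert v J) (set_diag v c1 a)"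
  let ?b2 = "restrict_block (insert v K) (set_diag v c2 a)"
  have "spn_on (insert v J) (set_diag v c1 a)"
    using fin c mono symmetric_on_subset[OF sym, of "insert v J"]
    by (intro copositive_monotone_imp_spn symmetric_on_set_diag monotone_offdiag_on_set_diag) auto
  moreover have "spn_on (insert v K) (set_diag v c2 a)"
    using fin c mono symmetric_on_subset[OF sym, of "insert v K"]
    by (intro copositive_monotone_imp_spn symmetric_on_set_diag monotone_offdiag_on_set_diag) auto
  ultimately have "spn_on (insert v (J \<union> K)) (\<lambda>i j. ?b1 i j + ?b2 i j)"
    using fin by (intro spn_on_add spn_on_restrict_block) auto
  moreover have "?b1 i j + ?b2 i j = a i j" if "i \<in> insert v (J \<union> K)" "j \<in> insert v (J \<union> K)" for i j
  proof -
    have "a i j = 0" if "i \<in> K" "j \<in> J" for i j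
      using zero[OF that(2,1)] sym that unfolding symmetric_on_def by auto
    then show ?thesis
      using that disj zero c(1) unfolding restrict_block_def set_diag_def by auto
  qed
  ultimately show ?thesis
    by (rule spn_on_cong)
qed

section \<open>Transfer to matrices\<close>

lemma quadratic_form_mat_eq_qform:
  assumes "A \<in> carrier_mat N N" "x \<in> carrier_vec N"
  shows "x \<bullet> (A *\<^sub>v x) = qform {..<N} (\<lambda>i j. A $$ (i, j)) (\<lambda>i. x $ i)"
  using assms unfolding qform_def
  by (auto simp: scalar_prod_def sum_distrib_left atLeast0LessThan ac_simps intro!: sum.cong)

lemma symmetric_mats_index:
  assumes "A \<in> symmetric_mats N" "i < N" "j < N"
  shows "A $$ (i, j) = A $$ (j, i)"
proof -
  have "A \<in> carrier_mat N N" "transpose_mat A = A"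
    using assms(1) unfolding symmetric_mats_def by auto
  then show ?thesis
    using assms(2,3) index_transpose_mat(1)[of j A i] by auto
qed

lemma copositive_cone_imp_copositive_on:
  assumes "A \<in> copositive_cone N"
  shows "copositive_on {..<N} (\<lambda>i j. A $$ (i, j))"
  unfolding copositive_on_def
proof (intro allI impI)
  fix x :: "nat \<Rightarrow> real"
  assume "\<forall>i\<in>{..<N}. 0 \<le> x i"
  then have "0\<^sub>v N \<le> vec N x"
    by (simp add: less_eq_vec_def)
  then have "0 \<le> vec N x \<bullet> (A *\<^sub>v vec N x)"
    using assms unfolding copositive_cone_def by simp
  also have "\<dots> = qform {..<N} (\<lambda>i j. A $$ (i, j)) (\<lambda>i. vec N x $ i)"
    using assms unfolding copositive_cone_def symmetric_mats_def
    by (intro quadratic_form_mat_eq_qform) auto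
  also have "\<dots> = qform {..<N} (\<lambda>i j. A $$ (i, j)) x"
    by (intro qform_cong) auto
  finally show "0 \<le> qform {..<N} (\<lambda>i j. A $$ (i, j)) x" .
qed

lemma spn_on_imp_spn_cone:
  assumes "A \<in> carrier_mat N N" "spn_on {..<N} (\<lambda>i j. A $$ (i, j))"
  shows "A \<in> spn_cone N"
proof -
  obtain p m where *: "symmetric_on {..<N} p" "\<forall>x. 0 \<le> qform {..<N} p x" "symmetric_on {..<N} m"
    "\<forall>i\<in>{..<N}. \<forall>j\<in>{..<N}. 0 \<le> m i j" "\<forall>i\<in>{..<N}. \<forall>j\<in>{..<N}. A $$ (i, j) = p i j + m i j"
    using assms(2) unfolding spn_on_def by blast
  define P where "P = mat N N (\<lambda>(i, j). p i j)"
  define M where "M = mat N N (\<lambda>(i, j). m i j)"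
  have "0 \<le> x \<bullet> (P *\<^sub>v x)" if "x \<in> carrier_vec N" for x
  proof -
    have "x \<bullet> (P *\<^sub>v x) = qform {..<N} (\<lambda>i j. P $$ (i, j)) (\<lambda>i. x $ i)"
      using that by (intro quadratic_form_mat_eq_qform) (auto simp: P_def)
    also have "\<dots> = qform {..<N} p (\<lambda>i. x $ i)"
      by (intro qform_cong) (auto simp: P_def)
    finally show ?thesis
      using *(2) by simp
  qed
  moreover have "P \<in> symmetric_mats N"
    using *(1) unfolding symmetric_mats_def symmetric_on_def P_def by auto
  ultimately have "P \<in> psd_cone N"
    unfolding psd_cone_def by simp
  moreover have "M \<in> nonneg_cone N"
    using *(3,4) unfolding nonneg_cone_def symmetric_mats_def symmetric_on_def M_def
    by (auto simp: less_eq_mat_def)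
  moreover have "A = P + M"
    using assms(1) *(5) unfolding P_def M_def by (intro eq_matI) auto
  ultimately show ?thesis
    unfolding spn_cone_def by blast
qed

lemma append_rows_index:
  assumes "i < dim_row A + dim_row B" "j < dim_col A"
  shows "(A @\<^sub>r B) $$ (i, j) = (if i < dim_row A then A $$ (i, j) else B $$ (i - dim_row A, j))"
  using assms unfolding append_rows_def by simp

lemma append_cols_index:
  assumes "i < dim_row A" "i < dim_row B" "j < dim_col A + dim_col B"
  shows "append_cols A B $$ (i, j) = (if j < dim_col A then A $$ (i, j) else B $$ (i, j - dim_col A))"
  using assms unfolding append_cols_def append_rows_def by simp

lemma dim_append_rows [simp]:
  "dim_row (A @\<^sub>r B) = dim_row A + dim_row B" "dim_col (A @\<^sub>r B) = dim_col A"
  unfolding append_rows_def by simp_all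

lemma dim_append_cols [simp]:
  "dim_row (append_cols A B) = dim_row A" "dim_col (append_cols A B) = dim_col A + dim_col B"
  unfolding append_cols_def by simp_all

lemma nine_block_mat_index:
  fixes A1 A2 :: "real mat" and b1 b2 :: "real vec" and c :: real
  assumes "A1 \<in> carrier_mat n n" "b1 \<in> carrier_vec n" "A2 \<in> carrier_mat k k" "b2 \<in> carrier_vec k"
    and "i < n + k + 1" "j < n + k + 1"
  defines "A \<equiv> nine_block_mat
               A1               (col_mat b1)    (0\<^sub>m n k)
               (mat_of_row b1)  (scalar_mat c)  (mat_of_row b2)
               (0\<^sub>m k n)         (col_mat b2)    A2"
  shows "i \<le> n \<Longrightarrow> j \<le> n \<Longrightarrow>
      A $$ (i, j) = four_block_mat A1 (col_mat b1) (mat_of_row b1) (scalar_mat c) $$ (i, j)"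
    and "n \<le> i \<Longrightarrow> n \<le> j \<Longrightarrow>
      A $$ (i, j) = four_block_mat (scalar_mat c) (mat_of_row b2) (col_mat b2) A2 $$ (i - n, j - n)"
    and "i < n \<Longrightarrow> n < j \<Longrightarrow> A $$ (i, j) = 0"
  using assms(1-6) unfolding A_def nine_block_mat_def
  by (auto simp: append_rows_index append_cols_index col_mat_def scalar_mat_def mat_of_row_def not_less)

section \<open>The glued block matrix\<close>

theorem proposition3p11:
  fixes n k :: nat
    and A A1 A2 :: "real mat"
    and b1 b2 :: "real vec"
    and c :: real
  assumes "A1 \<in> symmetric_mats n"
    and "b1 \<in> carrier_vec n"
    and "A2 \<in> symmetric_mats k"
    and "b2 \<in> carrier_vec k"
    and "A = nine_block_mat
               A1               (col_mat b1)    (0\<^sub>m n k)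
               (mat_of_row b1)  (scalar_mat c)  (mat_of_row b2)
               (0\<^sub>m k n)         (col_mat b2)    A2"
    and "A \<in> copositive_cone (n + k + 1)"
    and "four_block_mat A1 (col_mat b1) (mat_of_row b1) (scalar_mat c)
           \<in> monotone_offdiag_mats (n + 1)"
    and "four_block_mat (scalar_mat c) (mat_of_row b2) (col_mat b2) A2
           \<in> monotone_offdiag_mats (k + 1)"
  shows "A \<in> spn_cone (n + k + 1)"
proof -
  let ?N = "n + k + 1"
  let ?B1 = "four_block_mat A1 (col_mat b1) (mat_of_row b1) (scalar_mat c)"
  let ?B2 = "four_block_mat (scalar_mat c) (mat_of_row b2) (col_mat b2) A2"
  define a where "a = (\<lambda>i j. A $$ (i, j))"
  define J where "J = {..<n}"
  define K where "K = {n<..<?N}"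
  have split: "insert n (J \<union> K) = {..<?N}" "insert n J = {..<n + 1}" "insert n K = {n..<?N}"
    unfolding J_def K_def by auto
  have carrier: "A1 \<in> carrier_mat n n" "A2 \<in> carrier_mat k k"
    using assms(1,3) unfolding symmetric_mats_def by auto
  note index = nine_block_mat_index[OF carrier(1) assms(2) carrier(2) assms(4), of _ _ c,
      folded assms(5)]
  have A: "A \<in> symmetric_mats ?N"
    using assms(6) unfolding copositive_cone_def by blast
  have "spn_on (insert n (J \<union> K)) a"
  proof (rule copositive_glued_monotone_imp_spn)
    show "symmetric_on (insert n (J \<union> K)) a"
      unfolding symmetric_on_def split a_def using symmetric_mats_index[OF A] by auto
    show "copositive_on (insert n (J \<union> K)) a"
      unfolding split a_def using copositive_cone_imp_copositive_on[OF assms(6)] .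
    show "a i j = 0" if "i \<in> J" "j \<in> K" for i j
      using that unfolding a_def J_def K_def by (intro index(3)) auto
    show "monotone_offdiag_on (insert n J) a"
      unfolding monotone_offdiag_on_def split
    proof (intro ballI impI)
      fix p q r s
      assume *: "p \<in> {..<n + 1}" "q \<in> {..<n + 1}" "r \<in> {..<n + 1}" "s \<in> {..<n + 1}"
        "p \<le> r" "q \<le> s" "p \<noteq> q" "r \<noteq> s"
      then have "?B1 $$ (p, q) \<le> ?B1 $$ (r, s)"
        using assms(7) unfolding monotone_offdiag_mats_def by blast
      then show "a p q \<le> a r s"
        using * index(1)[of p q] index(1)[of r s] unfolding a_def by auto
    qed
    show "monotone_offdiag_on (insert n K) a"
      unfolding monotone_offdiag_on_def split
    proof (intro ballI impI)
      fix p q r s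
      assume *: "p \<in> {n..<?N}" "q \<in> {n..<?N}" "r \<in> {n..<?N}" "s \<in> {n..<?N}"
        "p \<le> r" "q \<le> s" "p \<noteq> q" "r \<noteq> s"
      then have "p - n < k + 1" "q - n < k + 1" "r - n < k + 1" "s - n < k + 1"
        "p - n \<le> r - n" "q - n \<le> s - n" "p - n \<noteq> q - n" "r - n \<noteq> s - n"
        by auto
      then have "?B2 $$ (p - n, q - n) \<le> ?B2 $$ (r - n, s - n)"
        using assms(8) unfolding monotone_offdiag_mats_def by blast
      then show "a p q \<le> a r s"
        using * index(2)[of p q] index(2)[of r s] unfolding a_def by auto
    qed
  qed (auto simp: J_def K_def)
  then show ?thesis
    using A spn_on_imp_spn_cone unfolding split a_def symmetric_mats_def by blast
qed

end
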